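(* Let $q$ be a complex number with $0<|q|<1$, and let $x$ be a complex number such that no denominator below vanishes, i.e. $x^2q^{8k+4}\neq 1$, $-xq^{k-1}\neq 1$ and $xq^{2k+1}\neq 1$ for all integers $k\ge 0$. Fix any choice of the complex square roots $\sqrt{-x}$, $\sqrt{-x/q}$, $\sqrt{xq}$. Then $${}_2\phi_1\left(\begin{matrix} xq^2,\ xq^6 \\ x^2q^4 \end{matrix};q^8,q^4\right)=\frac{(q;q)_\infty (xq;q^2)_\infty}{(q^4;q^8)_\infty (-xq^2;q^4)_\infty}\;{}_4\phi_3\left(\begin{matrix} \sqrt{-x},\ -\sqrt{-x},\ \sqrt{-x/q},\ -\sqrt{-x/q} \\ -x/q,\ \sqrt{xq},\ -\sqrt{xq}\end{matrix};q,q\right).$$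
   Context: For complex $a,p$ with $0<|p|<1$ and an integer $n\ge 0$, the shifted factorial is $(a;p)_n=\prod_{j=0}^{n-1}(1-ap^j)$ for $n>0$ and $(a;p)_0=1$; moreover $(a;p)_\infty=\prod_{j\ge 0}(1-ap^j)$. Also $(a_1,\dots,a_m;p)_n=(a_1;p)_n\cdots(a_m;p)_n$. The basic hypergeometric series with base $p$ and argument $z$ is $${}_{r+1}\phi_r\left(\begin{matrix} a_1,\dots,a_{r+1}\\ b_1,\dots,b_r\end{matrix};p,z\right)=\sum_{j=0}^\infty \frac{(a_1,\dots,a_{r+1};p)_j}{(p,b_1,\dots,b_r;p)_j}\,z^j.$$ *)

theory Defs
  imports "HOL-Analysis.Analysis"
begin

definition qpoch :: "complex \<Rightarrow> complex \<Rightarrow> nat \<Rightarrow> complex" where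
  "qpoch a p n = (\<Prod>j<n. 1 - a * p ^ j)"

definition qpoch_inf :: "complex \<Rightarrow> complex \<Rightarrow> complex" where
  "qpoch_inf a p = (\<Prod>j. 1 - a * p ^ j)"

definition qpoch_list :: "complex list \<Rightarrow> complex \<Rightarrow> nat \<Rightarrow> complex" where
  "qpoch_list as p n = (\<Prod>a\<leftarrow>as. qpoch a p n)"

text \<open>The formula below is the usual series only in the balanced case
  \<open>length as = length bs + 1\<close>; for other lengths the general basic hypergeometric series
  carries an additional factor.\<close>

definition basic_hypergeom ::
    "complex list \<Rightarrow> complex list \<Rightarrow> complex \<Rightarrow> complex \<Rightarrow> complex" where
  "basic_hypergeom as bs p z = (\<Sum>j. qpoch_list as p j / qpoch_list (p # bs) p j * z ^ j)"

end

theory Submission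
  imports Defs
begin

text \<open>
  Both sides of the transformation are the same partial theta function
  $\Theta = \sum_{n \ge 0} q^{2n^2} x^n$ up to explicit infinite products.

  Put $z = x/q$, $p = q^4$ and $y = xq^2$. On the right the pairs $\pm\sqrt{\cdot}$ merge, and the
  ${}_4\phi_3$ multiplied by $(xq;q^2)_\<infinity>$ becomes
  $\sum_j q^j (zq^{2j+2};q^2)_\<infinity> (-zq^j;q)_j / (q;q)_j$. On the left the ${}_2\phi_1$ multiplied by
  $(-y;p)_\<infinity>$ becomes
  $\sum_j p^j (y^2p^{2j};p^2)_j (-yp^{2j};p)_\<infinity> / (p^2;p^2)_j$.

  Each of these sums has the form $\sum_j w_j A_j B_j$ with $A_j$ and $B_j$ power series in $z$ or $y$ given by
  Euler's expansion of an infinite product and the $q$-binomial theorem. Extracting a coefficient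
  and summing over $j$ first, again by Euler, leaves a finite sum. In base $q$ it is
  evaluated by the $q$-Chu--Vandermonde sum (\<open>terminating_sum_base_q\<close>), in base $p$
  by telescoping (\<open>terminating_sum_base_p\<close>). The results are
  \<open>partial_theta_base_q\<close>, with value $\Theta / (q;q)_\<infinity>$, and
  \<open>partial_theta_base_p\<close>, with value $\Theta / (p;p^2)_\<infinity>$; eliminating $\Theta$ gives
  the theorem.
\<close>

section \<open>Shifted factorials\<close>

lemma qpoch_0 [simp]: "qpoch a p 0 = 1"
  by (simp add: qpoch_def)

lemma qpoch_Suc: "qpoch a p (Suc n) = qpoch a p n * (1 - a * p ^ n)"
  by (simp add: qpoch_def)

lemma qpoch_add: "qpoch a p (m + n) = qpoch a p m * qpoch (a * p ^ m) p n"
  by (induction n) (simp_all add: qpoch_Suc power_add mult.assoc)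

lemma qpoch_Suc_shift: "qpoch a p (Suc n) = (1 - a) * qpoch (a * p) p n"
  using qpoch_add[of a p 1 n] by (simp add: qpoch_Suc)

lemma qpoch_even_odd: "qpoch a (p ^ 2) n * qpoch (a * p) (p ^ 2) n = qpoch a p (2 * n)"
  by (induction n) (simp_all add: qpoch_Suc power_mult power_even_eq power_commutes mult_ac power2_eq_square power_mult_distrib)

lemma qpoch_minus: "qpoch a p n * qpoch (- a) p n = qpoch (a ^ 2) (p ^ 2) n"
proof (induction n)
  case (Suc n)
  have "(1 - a * p ^ n) * (1 - (- a) * p ^ n) = 1 - a ^ 2 * (p ^ 2) ^ n"
    by (simp add: algebra_simps power2_eq_square power_mult_distrib)
  then show ?case
    using Suc by (simp add: qpoch_Suc mult_ac)
qed simp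

lemma qpoch_nonzero: "qpoch a p n \<noteq> 0" if "\<And>k. a * p ^ k \<noteq> 1"
  using that by (simp add: qpoch_def eq_commute[of 1])

lemma power_neq_1: "q ^ Suc n \<noteq> 1" if "norm q < 1" for q :: complex
proof
  assume "q ^ Suc n = 1"
  then have "norm q ^ Suc n = 1"
    by (metis norm_one norm_power)
  moreover have "norm q ^ Suc n < 1"
    using that by (simp add: power_less_one_iff del: power_Suc)
  ultimately show False
    by simp
qed

lemma qpoch_self_nonzero: "qpoch q q n \<noteq> 0" if "norm q < 1"
  using power_neq_1[OF that] by (intro qpoch_nonzero) simp

section \<open>Gaussian binomial coefficients\<close>

text \<open>The closed quotient form makes the numerator cancel against the weight $1/(q;q)_j$ in the later
  summation over $j$; the value $0$ beyond $n$ lets finite expansions be treated as infinite series.\<close>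

definition qbinom :: "complex \<Rightarrow> nat \<Rightarrow> nat \<Rightarrow> complex" where
  "qbinom q n k = (if k \<le> n then qpoch q q n / (qpoch q q k * qpoch q q (n - k)) else 0)"

lemma qbinom_0_right: "qbinom q n 0 = 1" if "norm q < 1"
  using qpoch_self_nonzero[OF that] by (simp add: qbinom_def)

lemma qbinom_eq_0 [simp]: "n < k \<Longrightarrow> qbinom q n k = 0"
  by (simp add: qbinom_def)

lemma qbinom_Suc_Suc:
  assumes "norm q < 1" and "k \<le> n"
  shows "qbinom q (Suc n) (Suc k) = qbinom q n (Suc k) + q ^ (n - k) * qbinom q n k"
proof (cases "k = n")
  case True
  then show ?thesis
    using qpoch_self_nonzero[OF assms(1)] by (simp add: qbinom_def)
next
  case False
  define m where "m = n - Suc k"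
  have n: "n = Suc (k + m)"
    using False assms(2) by (simp add: m_def)
  have nz: "qpoch q q k \<noteq> 0" "qpoch q q m \<noteq> 0" "1 - q * q ^ k \<noteq> 0" "1 - q * q ^ m \<noteq> 0"
    using qpoch_self_nonzero[OF assms(1)] power_neq_1[OF assms(1)] by auto
  have "qbinom q (Suc n) (Suc k) = qpoch q q n * (1 - q * q ^ n) /
          (qpoch q q k * (1 - q * q ^ k) * (qpoch q q m * (1 - q * q ^ m)))"
    by (simp add: qbinom_def n qpoch_Suc Suc_diff_le)
  moreover have "qbinom q n (Suc k) = qpoch q q n / (qpoch q q k * (1 - q * q ^ k) * qpoch q q m)"
    by (simp add: qbinom_def n qpoch_Suc)
  moreover have "qbinom q n k = qpoch q q n / (qpoch q q k * (qpoch q q m * (1 - q * q ^ m)))"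
    by (simp add: qbinom_def n qpoch_Suc Suc_diff_le)
  moreover have "q ^ (n - k) = q * q ^ m" "q ^ n = q * q ^ k * q ^ m"
    by (simp_all add: n power_add Suc_diff_le)
  moreover have "N * (1 - X * Y) / (a * (1 - X) * (b * (1 - Y))) =
      N / (a * (1 - X) * b) + Y * (N / (a * (b * (1 - Y))))"
    if "a \<noteq> 0" "b \<noteq> 0" "1 - X \<noteq> 0" "1 - Y \<noteq> 0" for N X Y a b :: complex
    using that by (simp add: divide_simps) (simp add: algebra_simps)
  from this[OF nz(1,2,3,4), of "qpoch q q n"]
  have "qpoch q q n * (1 - q * (q * q ^ k * q ^ m)) /
          (qpoch q q k * (1 - q * q ^ k) * (qpoch q q m * (1 - q * q ^ m))) =
      qpoch q q n / (qpoch q q k * (1 - q * q ^ k) * qpoch q q m) +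
      q * q ^ m * (qpoch q q n / (qpoch q q k * (qpoch q q m * (1 - q * q ^ m))))"
    by (simp add: mult_ac)
  ultimately show ?thesis
    by simp
qed

text \<open>Pascal's rule under the summation sign: the common induction step of the $q$-binomial theorem and
  of the $q$-Chu--Vandermonde sum.\<close>

lemma sum_qbinom_Suc:
  assumes "norm q < 1"
  shows "(\<Sum>k\<le>Suc n. qbinom q (Suc n) k * F k) =
           (\<Sum>k\<le>n. qbinom q n k * (F k + q ^ (n - k) * F (Suc k)))"
proof -
  have "(\<Sum>k\<le>Suc n. qbinom q (Suc n) k * F k) =
          F 0 + (\<Sum>k\<le>n. qbinom q (Suc n) (Suc k) * F (Suc k))"
    by (simp only: sum.atMost_Suc_shift qbinom_0_right[OF assms] mult_1)
  also have "(\<Sum>k\<le>n. qbinom q (Suc n) (Suc k) * F (Suc k)) =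
          (\<Sum>k\<le>n. qbinom q n (Suc k) * F (Suc k)) + (\<Sum>k\<le>n. qbinom q n k * (q ^ (n - k) * F (Suc k)))"
    unfolding sum.distrib[symmetric]
    by (intro sum.cong refl) (simp add: qbinom_Suc_Suc[OF assms] algebra_simps)
  also have "F 0 + ((\<Sum>k\<le>n. qbinom q n (Suc k) * F (Suc k)) + (\<Sum>k\<le>n. qbinom q n k * (q ^ (n - k) * F (Suc k)))) =
      (\<Sum>k\<le>Suc n. qbinom q n k * F k) + (\<Sum>k\<le>n. qbinom q n k * (q ^ (n - k) * F (Suc k)))"
    by (simp only: sum.atMost_Suc_shift qbinom_0_right[OF assms] mult_1 add.assoc)
  also have "(\<Sum>k\<le>Suc n. qbinom q n k * F k) = (\<Sum>k\<le>n. qbinom q n k * F k)"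
    by simp
  finally show ?thesis
    by (simp add: sum.distrib ring_distribs)
qed

lemma Suc_choose_two: "Suc n choose 2 = n + (n choose 2)"
  by (simp add: numeral_2_eq_2)

lemma twice_choose_two: "2 * (n choose 2) + n = n * n"
  by (induction n) (simp_all add: Suc_choose_two)

theorem q_binomial:
  assumes "norm q < 1"
  shows "qpoch w q n = (\<Sum>k\<le>n. qbinom q n k * ((-1) ^ k * q ^ (k choose 2) * w ^ k))"
proof (induction n)
  case (Suc n)
  let ?F = "\<lambda>k. (-1) ^ k * q ^ (k choose 2) * w ^ k"
  have "?F k + q ^ (n - k) * ?F (Suc k) = ?F k * (1 - w * q ^ n)" if "k \<le> n" for k
  proof -
    have "q ^ n = q ^ (n - k) * q ^ k"
      using that by (simp flip: power_add)
    then show ?thesis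
      by (simp add: Suc_choose_two power_add algebra_simps)
  qed
  then show ?case
    unfolding sum_qbinom_Suc[OF assms] qpoch_Suc Suc.IH
    by (simp add: sum_distrib_right mult.assoc cong: sum.cong_simp)
qed (simp add: qbinom_0_right[OF assms] numeral_2_eq_2)

text \<open>With the denominators $(c;q)_k$ cleared, Pascal's rule combines two neighbouring summands into
  $q^n(b - c)$ times a summand of order $n$ with $c$ replaced by $cq$, so the induction is over
  $n$ with $c$ arbitrary.\<close>

theorem q_Chu_Vandermonde:
  assumes "norm q < 1"
  shows "(\<Sum>k\<le>n. qbinom q n k *
            ((-1) ^ k * q ^ ((n - k) choose 2) * qpoch b q k * qpoch (c * q ^ k) q (n - k))) =
         q ^ (n choose 2) * (\<Prod>i<n. b - c * q ^ i)"
proof (induction n arbitrary: c)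
  case 0
  then show ?case by (simp add: qbinom_0_right[OF assms] numeral_2_eq_2)
next
  case (Suc n)
  let ?F = "\<lambda>c n k. (-1) ^ k * q ^ ((n - k) choose 2) * qpoch b q k * qpoch (c * q ^ k) q (n - k)"
  have "?F c (Suc n) k + q ^ (n - k) * ?F c (Suc n) (Suc k) = q ^ n * (b - c) * ?F (c * q) n k"
    if "k \<le> n" for k
  proof -
    have q: "q ^ n = q ^ (n - k) * q ^ k"
      using that by (simp flip: power_add)
    have "?F c (Suc n) k = (-1) ^ k * (q ^ (n - k) * q ^ ((n - k) choose 2)) * qpoch b q k *
        ((1 - c * q ^ k) * qpoch (c * q ^ k * q) q (n - k))"
      using that by (simp only: Suc_diff_le Suc_choose_two power_add qpoch_Suc_shift)
    moreover have "?F c (Suc n) (Suc k) = - ((-1) ^ k * q ^ ((n - k) choose 2) *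
        (qpoch b q k * (1 - b * q ^ k)) * qpoch (c * q ^ k * q) q (n - k))"
      by (simp add: qpoch_Suc mult_ac)
    moreover have "c * q * q ^ k = c * q ^ k * q"
      by simp
    ultimately show ?thesis
      by (simp only: q) (simp add: algebra_simps)
  qed
  then have "(\<Sum>k\<le>Suc n. qbinom q (Suc n) k * ?F c (Suc n) k) =
      q ^ n * (b - c) * (\<Sum>k\<le>n. qbinom q n k * ?F (c * q) n k)"
    unfolding sum_qbinom_Suc[OF assms]
    by (simp add: sum_distrib_left mult_ac cong: sum.cong_simp)
  also have "\<dots> = q ^ n * q ^ (n choose 2) * ((b - c) * (\<Prod>i<n. b - c * q * q ^ i))"
    by (simp add: Suc.IH)
  also have "(b - c) * (\<Prod>i<n. b - c * q * q ^ i) = (\<Prod>i<Suc n. b - c * q ^ i)"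
    by (simp only: prod.lessThan_Suc_shift) (simp add: mult.assoc)
  finally show ?case
    by (simp add: Suc_choose_two power_add)
qed

section \<open>The two finite evaluations\<close>

text \<open>This is the $q$-Chu--Vandermonde sum with $b = q^{n+1}$ and $c = -q$, divided by $(-q;q)_n$. For
  these parameters the right-hand product equals $q^{\binom{n+1}{2}} (-q;q)_n$.\<close>

lemma terminating_sum_base_q:
  assumes q: "norm q < 1"
  shows "(\<Sum>k\<le>n. (-1) ^ k * q ^ ((n - k) choose 2) * qpoch q q (n + k) /
            (qpoch (q ^ 2) (q ^ 2) k * qpoch q q (n - k))) = q ^ (n * n)"
proof -
  note nz = qpoch_self_nonzero[OF q]
  have sq: "qpoch q q k * qpoch (- q) q k = qpoch (q ^ 2) (q ^ 2) k" for k
    by (rule qpoch_minus)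
  have "norm (q ^ 2) < 1"
    using q by (simp add: norm_power power_less_one_iff)
  then have nz': "qpoch (- q) q k \<noteq> 0" for k
    using sq[of k] qpoch_self_nonzero[of "q ^ 2" k] by auto
  have term_eq: "(-1) ^ k * q ^ ((n - k) choose 2) * qpoch q q (n + k) /
            (qpoch (q ^ 2) (q ^ 2) k * qpoch q q (n - k)) =
          qbinom q n k * ((-1) ^ k * q ^ ((n - k) choose 2) * qpoch (q * q ^ n) q k *
            qpoch (- q * q ^ k) q (n - k)) / qpoch (- q) q n" if "k \<le> n" for k
  proof -
    have "qpoch (- q) q n = qpoch (- q) q k * qpoch (- q * q ^ k) q (n - k)"
      using qpoch_add[of "- q" q k "n - k"] that by simp
    moreover from this have "qpoch (- q * q ^ k) q (n - k) \<noteq> 0"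
      using nz'[of n] by auto
    moreover have "qpoch q q (n + k) = qpoch q q n * qpoch (q * q ^ n) q k"
      by (rule qpoch_add)
    ultimately show ?thesis
      unfolding sq[symmetric] using that nz nz' by (simp add: qbinom_def mult_ac)
  qed
  have prod: "(\<Prod>i<n. q * q ^ n - (- q) * q ^ i) = q ^ (Suc n choose 2) * qpoch (- q) q n" for n
  proof (induction n)
    case (Suc n)
    have "(\<Prod>i<Suc n. q * q ^ Suc n - (- q) * q ^ i) =
        (q * q ^ Suc n + q) * (\<Prod>i<n. q * (q * q ^ n - (- q) * q ^ i))"
      by (simp only: prod.lessThan_Suc_shift) (simp add: algebra_simps)
    also have "\<dots> = (q * q ^ Suc n + q) * (q ^ n * (q ^ (Suc n choose 2) * qpoch (- q) q n))"
      by (simp add: prod.distrib Suc.IH[symmetric])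
    also have "\<dots> = q ^ (Suc (Suc n) choose 2) * qpoch (- q) q (Suc n)"
      by (simp add: Suc_choose_two[of "Suc n"] power_add qpoch_Suc algebra_simps)
    finally show ?case .
  qed (simp add: numeral_2_eq_2)
  have "(\<Sum>k\<le>n. (-1) ^ k * q ^ ((n - k) choose 2) * qpoch q q (n + k) /
            (qpoch (q ^ 2) (q ^ 2) k * qpoch q q (n - k))) =
        q ^ (n choose 2) * (\<Prod>i<n. q * q ^ n - (- q) * q ^ i) / qpoch (- q) q n"
    unfolding q_Chu_Vandermonde[OF q, symmetric] sum_divide_distrib
    by (intro sum.cong refl term_eq) simp
  also have "\<dots> = q ^ ((n choose 2) + (Suc n choose 2))"
    unfolding prod using nz'[of n] by (simp add: power_add)
  also have "(n choose 2) + (Suc n choose 2) = n * n"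
    using twice_choose_two[of n] by (simp add: Suc_choose_two)
  finally show ?thesis .
qed

text \<open>This is a $q$-Chu--Vandermonde sum in base $p^2$ whose form depends on the parity of $n$. A
  telescoping proof treats both parities at once: if $t(n,k)$ is the summand, then $t(n+1,k) - t(n,k)$
  is the difference $g(n,k+1) - g(n,k)$ of Gosper's antidifference $g$, so the sum is independent
  of $n$.\<close>

lemma terminating_sum_base_p:
  assumes p0: "p \<noteq> 0" and p: "norm p < 1"
  shows "(\<Sum>k | 2 * k \<le> n. (-1) ^ k * p ^ (k * Suc k) * qpoch p (p ^ 2) (n - k) /
            (qpoch (p ^ 2) (p ^ 2) k * qpoch p p (n - 2 * k))) = 1"
proof -
  have p2: "norm (p ^ 2) < 1"
    using p by (simp add: norm_power power_less_one_iff)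
  \<comment> \<open>With $1/(p;p)_m = 0$ for $m < 0$, the summation range can be extended to all $k \<le> n$.\<close>
  define r where "r n k = (if 2 * k \<le> n then 1 / qpoch p p (n - 2 * k) else 0)" for n k
  define t where "t n k = (-1) ^ k * p ^ (k * Suc k) * qpoch p (p ^ 2) (n - k) *
    r n k / qpoch (p ^ 2) (p ^ 2) k" for n k
  define g where "g n k = (case k of 0 \<Rightarrow> 0 | Suc i \<Rightarrow> p ^ Suc n / (1 - p ^ Suc n) *
    ((-1) ^ i * p ^ (i * Suc i) * qpoch p (p ^ 2) (n - i) * r (Suc n) (Suc i) / qpoch (p ^ 2) (p ^ 2) i))"
    for n k
  have tele: "t (Suc n) k - t n k = g n (Suc k) - g n k" if "k \<le> Suc n" for n k
  proof (cases "2 * k \<le> Suc n")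
    case False
    then show ?thesis
      by (cases k) (auto simp: t_def g_def r_def)
  next
    case True
    then have kn: "k \<le> n"
      by (cases k) auto
    define a where "a = p ^ (Suc n - 2 * k)"
    define b where "b = p ^ (n - 2 * k)"
    define X where "X = p ^ (2 * k)"
    define N where "N = p ^ Suc n"
    define e where "e = p * (p ^ 2) ^ (n - k)"
    define A where "A = (-1) ^ k * p ^ (k * Suc k) * qpoch p (p ^ 2) (n - k) / qpoch (p ^ 2) (p ^ 2) k"
    define R where "R = r (Suc n) k"
    have X0: "X \<noteq> 0" and N1: "1 - N \<noteq> 0"
      using p0 power_neq_1[OF p, of n] by (auto simp: X_def N_def)
    have N: "N = a * X"
      using True unfolding a_def N_def X_def by (simp flip: power_add power_Suc)
    have r_Suc: "r (Suc n) (Suc k) = R * (1 - a) * (1 - b)" and r: "r n k = R * (1 - a)"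
    proof -
      have "r (Suc n) (Suc k) = R * (1 - a) * (1 - b) \<and> r n k = R * (1 - a)"
      proof (cases "2 * k = Suc n")
        case True
        then show ?thesis by (simp add: r_def a_def)
      next
        case False
        define m where "m = n - 2 * k"
        have n: "n = m + 2 * k"
          using False \<open>2 * k \<le> Suc n\<close> by (simp add: m_def)
        have R: "R = 1 / (qpoch p p m * (1 - p * p ^ m))" and ab: "a = p * p ^ m" "b = p ^ m"
          by (simp_all add: R_def r_def a_def b_def n Suc_diff_le qpoch_Suc)
        have nz: "qpoch p p m \<noteq> 0" "1 - p * p ^ m \<noteq> 0"
          using qpoch_self_nonzero[OF p] power_neq_1[OF p, of m] by auto
        have "r n k = 1 / qpoch p p m"
          by (simp add: r_def n)
        moreover have "r (Suc n) (Suc k) = (1 - p ^ m) / qpoch p p m"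
          using qpoch_self_nonzero[OF p] power_neq_1[OF p]
          by (cases m) (simp_all add: r_def n qpoch_Suc)
        ultimately show ?thesis
          using nz by (simp add: R ab)
      qed
      then show "r (Suc n) (Suc k) = R * (1 - a) * (1 - b)" "r n k = R * (1 - a)"
        by auto
    qed
    have t_Suc: "t (Suc n) k = (1 - e) * (A * R)"
      using kn by (simp add: t_def A_def R_def e_def Suc_diff_le qpoch_Suc)
    have t: "t n k = (1 - a) * (A * R)"
      using kn by (simp add: t_def A_def r)
    have g_Suc: "g n (Suc k) = N / (1 - N) * ((1 - a) * (1 - b)) * (A * R)"
      by (simp add: g_def A_def r_Suc N_def)
    have g: "g n k = - (N / (1 - N) * ((1 - e) * (1 - X) / X)) * (A * R)"
    proof (cases k)
      case 0
      then show ?thesis by (simp add: g_def X_def)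
    next
      case (Suc i)
      have "A = - ((-1) ^ i * p ^ (i * Suc i) * X * qpoch p (p ^ 2) (n - k) /
          (qpoch (p ^ 2) (p ^ 2) i * (1 - X)))"
      proof -
        have "k * Suc k = i * Suc i + 2 * k"
          by (simp add: Suc)
        then have "p ^ (k * Suc k) = p ^ (i * Suc i) * X"
          by (simp only: X_def power_add)
        moreover have "qpoch (p ^ 2) (p ^ 2) k = qpoch (p ^ 2) (p ^ 2) i * (1 - X)"
          by (simp only: Suc qpoch_Suc X_def power_mult power_Suc)
        moreover have "(-1) ^ k = - ((-1) ^ i :: complex)"
          by (simp add: Suc)
        ultimately show ?thesis
          by (simp only: A_def) simp
      qed
      moreover have "1 - X \<noteq> 0"
        using power_neq_1[OF p, of "Suc (2 * i)"] by (simp add: X_def Suc)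
      moreover have "qpoch p (p ^ 2) (n - i) = qpoch p (p ^ 2) (n - k) * (1 - e)"
      proof -
        have "n - i = Suc (n - k)"
          using kn Suc by simp
        then show ?thesis
          by (simp add: e_def qpoch_Suc)
      qed
      ultimately show ?thesis
        using X0 by (simp add: g_def Suc N_def R_def)
    qed
    \<comment> \<open>Up to the common factor $AR$ this is the telescoping relation; it holds since $N = aX$ and, away from
      the boundary $2k = n + 1$, also $e = abX$.\<close>
    have "(1 - e) - (1 - a) = N / (1 - N) * ((1 - a) * (1 - b)) + N / (1 - N) * ((1 - e) * (1 - X) / X)"
    proof (cases "2 * k = Suc n")
      case True
      then have "a = 1" 
        by (simp add: a_def)
      then show ?thesis 
        using N N1 X0 by simp
    next
      case False
      then have "e = p ^ Suc (2 * (n - k))" "Suc n - 2 * k + (n - 2 * k) + 2 * k = Suc (2 * (n - k))"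
        using \<open>2 * k \<le> Suc n\<close> by (simp_all add: e_def power_mult)
      then have e: "e = a * b * X"
        by (simp only: a_def b_def X_def flip: power_add)
      have "(a - a * b * X) * X * (1 - a * X) =
          a * X * ((1 - a) * (1 - b) * X + (1 - a * b * X) * (1 - X))"
        by (simp add: algebra_simps)
      then show ?thesis
        using N1 X0 unfolding e N by (simp add: divide_simps) (simp add: algebra_simps)
    qed
    then have "((1 - e) - (1 - a)) * (A * R) =
        (N / (1 - N) * ((1 - a) * (1 - b)) + N / (1 - N) * ((1 - e) * (1 - X) / X)) * (A * R)"
      by simp
    then show ?thesis
      unfolding t_Suc t g_Suc g by (simp only: left_diff_distrib distrib_right minus_mult_left[symmetric] diff_minus_eq_add)
  qed
  have "(\<Sum>k\<le>n. t n k) = 1"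
  proof (induction n)
    case (Suc n)
    have "(\<Sum>k\<le>Suc n. t (Suc n) k) - (\<Sum>k\<le>Suc n. t n k) = (\<Sum>k\<le>Suc n. g n (Suc k) - g n k)"
      unfolding sum_subtractf[symmetric] by (intro sum.cong refl tele) simp
    also have "\<dots> = g n (Suc (Suc n)) - g n 0"
      unfolding lessThan_Suc_atMost[symmetric] by (rule sum_lessThan_telescope)
    also have "\<dots> = 0"
      by (simp add: g_def r_def)
    also have "(\<Sum>k\<le>Suc n. t n k) = (\<Sum>k\<le>n. t n k)"
      by (simp add: t_def r_def)
    finally show ?case
      using Suc by simp
  qed (simp add: t_def r_def)
  moreover have "(\<Sum>k\<le>n. t n k) = (\<Sum>k | 2 * k \<le> n. t n k)"
    by (rule sum.mono_neutral_right) (auto simp: t_def r_def)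
  moreover have "(\<Sum>k | 2 * k \<le> n. t n k) = (\<Sum>k | 2 * k \<le> n. (-1) ^ k * p ^ (k * Suc k) *
      qpoch p (p ^ 2) (n - k) / (qpoch (p ^ 2) (p ^ 2) k * qpoch p p (n - 2 * k)))"
    by (intro sum.cong refl) (simp add: t_def r_def)
  ultimately show ?thesis
    by simp
qed

section \<open>Infinite products and Euler's expansions\<close>

lemma convergent_prod_qpoch: "convergent_prod (\<lambda>j. 1 - a * p ^ j)" if "norm p < 1" for a p :: complex
proof -
  have "summable (\<lambda>j. norm a * norm p ^ j)"
    using that by (intro summable_mult summable_geometric) simp
  then have "abs_convergent_prod (\<lambda>j. 1 - a * p ^ j)"
    by (simp add: abs_convergent_prod_conv_summable norm_mult norm_power)
  then show ?thesis
    by (rule abs_convergent_prod_imp_convergent_prod)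
qed

lemma qpoch_LIMSEQ: "(\<lambda>n. qpoch a p n) \<longlonglongrightarrow> qpoch_inf a p" if "norm p < 1"
proof -
  have "(\<lambda>n. qpoch a p (Suc n)) \<longlonglongrightarrow> qpoch_inf a p"
    using convergent_prod_LIMSEQ[OF convergent_prod_qpoch[OF that]]
    by (simp only: qpoch_def qpoch_inf_def lessThan_Suc_atMost)
  then show ?thesis
    by (simp only: filterlim_sequentially_Suc)
qed

lemma qpoch_inf_split: "qpoch_inf a p = qpoch a p n * qpoch_inf (a * p ^ n) p" if "norm p < 1"
proof (rule LIMSEQ_unique)
  show "(\<lambda>m. qpoch a p (n + m)) \<longlonglongrightarrow> qpoch_inf a p"
    using LIMSEQ_ignore_initial_segment[OF qpoch_LIMSEQ[OF that, of a], of n] by (simp add: add.commute)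
  show "(\<lambda>m. qpoch a p (n + m)) \<longlonglongrightarrow> qpoch a p n * qpoch_inf (a * p ^ n) p"
    unfolding qpoch_add by (intro tendsto_intros qpoch_LIMSEQ that)
qed

lemma qpoch_inf_nonzero: "qpoch_inf a p \<noteq> 0" if "norm p < 1" "\<And>k. a * p ^ k \<noteq> 1"
proof -
  have "1 - a * p ^ k \<noteq> 0" for k
    using that(2)[of k] by auto
  then show ?thesis
    unfolding qpoch_inf_def by (intro prodinf_nonzero convergent_prod_qpoch that(1))
qed

lemma qpoch_inf_self_nonzero: "qpoch_inf q q \<noteq> 0" if "norm q < 1"
  using power_neq_1[OF that] by (intro qpoch_inf_nonzero that) simp

lemma qpoch_bounded: "\<exists>C\<ge>0. \<forall>n. norm (qpoch a p n) \<le> C" if "norm p < 1"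
proof -
  have "Bseq (qpoch a p)"
    using qpoch_LIMSEQ[OF that] by (intro convergent_imp_Bseq convergentI)
  then show ?thesis
    by (meson BseqE less_imp_le)
qed

lemma qpoch_self_inverse_bounded: "\<exists>C\<ge>0. \<forall>n. norm (1 / qpoch q q n) \<le> C" if "norm q < 1"
proof -
  have "(\<lambda>n. 1 / qpoch q q n) \<longlonglongrightarrow> 1 / qpoch_inf q q"
    using qpoch_inf_self_nonzero[OF that] by (intro tendsto_intros qpoch_LIMSEQ that)
  then have "Bseq (\<lambda>n. 1 / qpoch q q n)"
    by (intro convergent_imp_Bseq convergentI)
  then show ?thesis
    by (meson BseqE less_imp_le)
qed

lemma qbinom_bounded: "\<exists>C\<ge>0. \<forall>n k. norm (qbinom q n k) \<le> C / norm (qpoch q q k)" if q: "norm q < 1"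
proof -
  obtain C where C: "C \<ge> 0" "\<And>n. norm (qpoch q q n) \<le> C"
    using qpoch_bounded[OF q] by blast
  obtain D where D: "D \<ge> 0" "\<And>n. norm (1 / qpoch q q n) \<le> D"
    using qpoch_self_inverse_bounded[OF q] by blast
  have "norm (qbinom q n k) \<le> C * D / norm (qpoch q q k)" for n k
  proof (cases "k \<le> n")
    case True
    then have "norm (qbinom q n k) =
        norm (qpoch q q n) * norm (1 / qpoch q q (n - k)) / norm (qpoch q q k)"
      by (simp add: qbinom_def norm_divide norm_mult)
    also have "\<dots> \<le> C * D / norm (qpoch q q k)"
      using C D by (intro divide_right_mono mult_mono) auto
    finally show ?thesis .
  qed (use C D in simp)
  then show ?thesis
    using C(1) D(1) by (intro exI[of _ "C * D"]) auto
qed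

text \<open>The quadratic exponent beats every geometric growth, which is why the theta series and the
  expansion of $(w;q)_\<infinity>$ are valid for arbitrary arguments.\<close>

lemma summable_partial_theta:
  fixes q w :: complex
  assumes q: "norm q < 1"
  shows "summable (\<lambda>k. norm q ^ (k choose 2) * norm w ^ k)"
proof -
  have "(\<lambda>n. norm q ^ n * norm w) \<longlonglongrightarrow> 0 * norm w"
    using q by (intro tendsto_intros LIMSEQ_power_zero) simp
  then have "eventually (\<lambda>n. norm q ^ n * norm w < 1 / 2) sequentially"
    by (rule order_tendstoD) simp
  then obtain N where N: "\<And>n. n \<ge> N \<Longrightarrow> norm q ^ n * norm w < 1 / 2"
    by (auto simp: eventually_sequentially)
  show ?thesis
  proof (rule summable_ratio_test)
    show "(1 / 2 :: real) < 1" by simp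
    fix n assume "N \<le> n"
    from N[OF this] have "norm q ^ n * norm w * (norm q ^ (n choose 2) * norm w ^ n) \<le>
        1 / 2 * (norm q ^ (n choose 2) * norm w ^ n)"
      by (intro mult_right_mono) auto
    then show "norm (norm q ^ (Suc n choose 2) * norm w ^ Suc n) \<le>
        1 / 2 * norm (norm q ^ (n choose 2) * norm w ^ n)"
      by (simp add: Suc_choose_two power_add mult_ac)
  qed
qed

lemma summable_Euler_terms:
  assumes q: "norm q < 1"
  shows "summable (\<lambda>k. norm ((-1) ^ k * q ^ (k choose 2) * w ^ k / qpoch q q k))"
proof -
  obtain D where D: "D \<ge> 0" "\<And>n. norm (1 / qpoch q q n) \<le> D"
    using qpoch_self_inverse_bounded[OF q] by blast
  have "summable (\<lambda>k. norm q ^ (k choose 2) * norm w ^ k * D)"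
    by (intro summable_mult2 summable_partial_theta q)
  moreover have "norm ((-1) ^ k * q ^ (k choose 2) * w ^ k / qpoch q q k) \<le>
      norm q ^ (k choose 2) * norm w ^ k * D" for k
    using mult_left_mono[OF D(2)[of k], of "norm q ^ (k choose 2) * norm w ^ k"]
    by (simp add: norm_mult norm_divide norm_power)
  ultimately show ?thesis
    by (intro summable_norm_comparison_test exI allI impI)
qed

text \<open>Iterating a functional equation $w \<mapsto> wq$ drives the argument to $0$; this lemma identifies the
  limit in both of Euler's expansions.\<close>

lemma powser_geometric_limit:
  fixes a :: "nat \<Rightarrow> complex"
  assumes "summable (\<lambda>k. a k * w ^ k)" and "norm q < 1"
  shows "(\<lambda>n. \<Sum>k. a k * (w * q ^ n) ^ k) \<longlonglongrightarrow> a 0"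
proof (cases "w = 0")
  case False
  then have "isCont (\<lambda>z. \<Sum>k. a k * z ^ k) 0"
    by (intro isCont_powser[OF assms(1)]) simp
  moreover have "(\<lambda>n. w * q ^ n) \<longlonglongrightarrow> w * 0"
    using assms(2) by (intro tendsto_intros LIMSEQ_power_zero)
  ultimately show ?thesis
    using isCont_tendsto_compose[of 0 "\<lambda>z. \<Sum>k. a k * z ^ k" "\<lambda>n. w * q ^ n" sequentially] by simp
qed simp

lemma powser_q_difference:
  fixes a :: "nat \<Rightarrow> complex"
  assumes "summable (\<lambda>k. a k * w ^ k)" and "summable (\<lambda>k. a k * (w * q) ^ k)"
  shows "(\<Sum>k. a k * w ^ k) - (\<Sum>k. a k * (w * q) ^ k) =
           (\<Sum>k. a (Suc k) * (1 - q ^ Suc k) * w ^ Suc k)"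
proof -
  have "(\<Sum>k. a k * w ^ k) - (\<Sum>k. a k * (w * q) ^ k) = (\<Sum>k. a k * w ^ k - a k * (w * q) ^ k)"
    by (rule suminf_diff[OF assms])
  also have "\<dots> = (\<Sum>k. a (Suc k) * w ^ Suc k - a (Suc k) * (w * q) ^ Suc k)"
    using suminf_split_head[OF summable_diff[OF assms]] by simp
  also have "\<dots> = (\<Sum>k. a (Suc k) * (1 - q ^ Suc k) * w ^ Suc k)"
    by (simp add: algebra_simps power_mult_distrib)
  finally show ?thesis .
qed

text \<open>The series $E$ satisfies $E(w) = (1 - w) E(wq)$, hence $E(w) = (w;q)_n E(wq^n)$, and $n$ tends to
  infinity.\<close>

theorem Euler_sum_product:
  assumes q: "norm q < 1"
  shows "(\<lambda>k. (-1) ^ k * q ^ (k choose 2) * w ^ k / qpoch q q k) sums qpoch_inf w q"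
proof -
  define a where "a k = (-1) ^ k * q ^ (k choose 2) / qpoch q q k" for k
  define E where "E w = (\<Sum>k. a k * w ^ k)" for w
  have summ: "summable (\<lambda>k. a k * w ^ k)" for w
    using summable_norm_cancel[OF summable_Euler_terms[OF q, of w]] by (simp add: a_def)
  have step: "E w = (1 - w) * E (w * q)" for w
  proof -
    have "a (Suc k) * (1 - q ^ Suc k) * w ^ Suc k = - w * (a k * (w * q) ^ k)" for k
      using qpoch_self_nonzero[OF q] power_neq_1[OF q, of k]
      by (simp add: a_def Suc_choose_two power_add qpoch_Suc power_mult_distrib)
    then have "E w - E (w * q) = - w * E (w * q)"
      unfolding E_def powser_q_difference[OF summ summ] by (simp only: suminf_mult[OF summ])
    then show ?thesis
      by (simp add: algebra_simps)
  qed
  have "E w = qpoch w q n * E (w * q ^ n)" for n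
  proof (induction n)
    case (Suc n)
    then show ?case
      using step[of "w * q ^ n"] by (simp add: qpoch_Suc mult_ac)
  qed simp
  moreover have "(\<lambda>n. qpoch w q n * E (w * q ^ n)) \<longlonglongrightarrow> qpoch_inf w q * a 0"
    unfolding E_def by (intro tendsto_mult qpoch_LIMSEQ powser_geometric_limit summ q)
  ultimately have "(\<lambda>n::nat. E w) \<longlonglongrightarrow> qpoch_inf w q * a 0"
    by simp
  then have "E w = qpoch_inf w q"
    by (simp add: LIMSEQ_const_iff a_def numeral_2_eq_2)
  then show ?thesis
    using summable_sums[OF summ[of w]] by (simp add: E_def a_def)
qed

text \<open>Here the functional equation is $E(wq) = (1 - w) E(w)$. The restriction on $w$ is the radius of
  convergence.\<close>

theorem Euler_sum_inverse:
  assumes q: "norm q < 1" and w: "norm w < 1"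
  shows "(\<lambda>k. w ^ k / qpoch q q k) sums (1 / qpoch_inf w q)"
proof -
  define a where "a k = 1 / qpoch q q k" for k
  define E where "E w = (\<Sum>k. a k * w ^ k)" for w
  obtain D where D: "D \<ge> 0" "\<And>n. norm (1 / qpoch q q n) \<le> D"
    using qpoch_self_inverse_bounded[OF q] by blast
  have summ: "summable (\<lambda>k. a k * w ^ k)" if "norm w < 1" for w
  proof (rule summable_comparison_test'[where N = 0])
    show "summable (\<lambda>k. D * norm w ^ k)"
      using that by (intro summable_mult summable_geometric) simp
    show "norm (a k * w ^ k) \<le> D * norm w ^ k" for k
      using mult_right_mono[OF D(2)[of k], of "norm w ^ k"]
      by (simp add: a_def norm_mult norm_divide norm_power)
  qed
  have small: "norm (w * q ^ n) < 1" for n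
  proof -
    have "norm w * norm q ^ n \<le> norm w * 1"
      using q by (intro mult_left_mono power_le_one) auto
    then show ?thesis
      using w by (simp add: norm_mult norm_power)
  qed
  have step: "E (v * q) = (1 - v) * E v" if "norm v < 1" "norm (v * q) < 1" for v
  proof -
    have "a (Suc k) * (1 - q ^ Suc k) * v ^ Suc k = v * (a k * v ^ k)" for k
      using qpoch_self_nonzero[OF q] power_neq_1[OF q, of k]
      by (simp add: a_def qpoch_Suc)
    then have "E v - E (v * q) = v * E v"
      unfolding E_def powser_q_difference[OF summ[OF that(1)] summ[OF that(2)]]
      by (simp only: suminf_mult[OF summ[OF that(1)]])
    then show ?thesis
      by (simp add: algebra_simps)
  qed
  have "E (w * q ^ n) = qpoch w q n * E w" for n
  proof (induction n)
    case (Suc n)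
    then show ?case
      using step[of "w * q ^ n"] small[of n] small[of "Suc n"] by (simp add: qpoch_Suc mult_ac)
  qed simp
  moreover have "(\<lambda>n. E (w * q ^ n)) \<longlonglongrightarrow> a 0"
    unfolding E_def by (intro powser_geometric_limit summ q w)
  moreover have "(\<lambda>n. qpoch w q n * E w) \<longlonglongrightarrow> qpoch_inf w q * E w"
    by (intro tendsto_intros qpoch_LIMSEQ q)
  ultimately have "qpoch_inf w q * E w = a 0"
    by (auto intro: LIMSEQ_unique)
  moreover have "a 0 = 1"
    by (simp add: a_def)
  ultimately have "E w = 1 / qpoch_inf w q"
    by (metis mult_zero_left nonzero_mult_div_cancel_left zero_neq_one)
  then show ?thesis
    using summable_sums[OF summ[OF w]] by (simp add: E_def a_def)
qed

section \<open>Interchanging summations\<close>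

lemma sums_swap_dominated:
  fixes f :: "nat \<Rightarrow> nat \<Rightarrow> complex"
  assumes bound: "\<And>j n. norm (f j n) \<le> u j * v n"
    and u: "summable u" "\<And>j. u j \<ge> 0" and v: "summable v" "\<And>n. v n \<ge> (0::real)"
  shows "(\<lambda>j. \<Sum>n. f j n) sums (\<Sum>n. \<Sum>j. f j n)"
proof -
  have u': "u summable_on UNIV" and v': "v summable_on UNIV"
    using u v by (simp_all add: summable_on_UNIV_nonneg_real_iff)
  have "(\<lambda>x. norm (case x of (j, n) \<Rightarrow> u j * v n)) summable_on UNIV \<times> UNIV"
  proof (rule Infinite_Sum.abs_summable_on_Sigma_iff[THEN iffD2], intro conjI ballI)
    show "(\<lambda>n. norm (case (j, n) of (j, n) \<Rightarrow> u j * v n)) summable_on UNIV" for j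
      using summable_on_cmult_right[OF v'] u(2) v(2) by (simp add: abs_mult)
    have "(\<Sum>\<^sub>\<infinity>n. norm (case (j, n) of (j, n) \<Rightarrow> u j * v n)) = u j * infsum v UNIV" for j
      using u(2) v(2) by (simp add: abs_mult infsum_cmult_right')
    then show "(\<lambda>j. norm (\<Sum>\<^sub>\<infinity>n. norm (case (j, n) of (j, n) \<Rightarrow> u j * v n))) summable_on UNIV"
      using summable_on_cmult_left[OF u', of "infsum v UNIV"] u(2) v(2)
      by (simp add: abs_mult infsum_nonneg)
  qed
  then have "(\<lambda>x. norm (case x of (j, n) \<Rightarrow> f j n)) summable_on UNIV \<times> UNIV"
    by (rule Infinite_Sum.abs_summable_on_comparison_test) (use bound u v in auto)
  then have "(\<lambda>(j, n). f j n) summable_on UNIV \<times> UNIV"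
    by (rule abs_summable_summable)
  then obtain S where S: "((\<lambda>(j, n). f j n) has_sum S) (UNIV \<times> UNIV)"
    by (auto simp: summable_on_def)
  then have S': "((\<lambda>(n, j). f j n) has_sum S) (UNIV \<times> UNIV)"
    by (subst (asm) has_sum_swap) simp
  have row: "(f j has_sum (\<Sum>n. f j n)) UNIV" for j
  proof (rule norm_summable_imp_has_sum)
    show "summable (\<lambda>n. norm (f j n))"
      by (rule summable_norm_comparison_test[OF _ summable_mult[OF v(1), of "u j"]]) (use bound in auto)
    then show "f j sums (\<Sum>n. f j n)"
      by (rule summable_sums[OF summable_norm_cancel])
  qed
  have col: "((\<lambda>j. f j n) has_sum (\<Sum>j. f j n)) UNIV" for n
  proof (rule norm_summable_imp_has_sum)
    show "summable (\<lambda>j. norm (f j n))"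
      by (rule summable_norm_comparison_test[OF _ summable_mult2[OF u(1), of "v n"]]) (use bound in auto)
    then show "(\<lambda>j. f j n) sums (\<Sum>j. f j n)"
      by (rule summable_sums[OF summable_norm_cancel])
  qed
  have "((\<lambda>j. \<Sum>n. f j n) has_sum S) UNIV"
    by (rule has_sum_Sigma'[OF S]) (use row in simp)
  moreover have "((\<lambda>n. \<Sum>j. f j n) has_sum S) UNIV"
    by (rule has_sum_Sigma'[OF S']) (use col in simp)
  ultimately show ?thesis
    using has_sum_imp_sums sums_unique by metis
qed

text \<open>The shape shared by both sides of the transformation: a weighted sum over $j$ of products of two power
  series. Bounds uniform in $j$ allow the $j$-summation to be carried out first, separately for each
  pair of coefficients.\<close>

lemma sums_weighted_products:
  fixes w :: "nat \<Rightarrow> complex" and \<alpha> \<beta> :: "nat \<Rightarrow> nat \<Rightarrow> complex"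
  assumes w: "summable (\<lambda>j. norm (w j))"
    and \<alpha>: "\<And>j k. norm (\<alpha> j k) \<le> A k" and A: "summable A"
    and \<beta>: "\<And>j k. norm (\<beta> j k) \<le> B k" and B: "summable B"
  shows "(\<lambda>j. w j * ((\<Sum>k. \<alpha> j k) * (\<Sum>k. \<beta> j k))) sums
           (\<Sum>n. \<Sum>k\<le>n. \<Sum>j. w j * \<alpha> j k * \<beta> j (n - k))"
proof -
  have A0: "A k \<ge> 0" and B0: "B k \<ge> 0" for k
    using order_trans[OF norm_ge_zero \<alpha>] order_trans[OF norm_ge_zero \<beta>] by auto
  have \<alpha>': "summable (\<lambda>k. norm (\<alpha> j k))" and \<beta>': "summable (\<lambda>k. norm (\<beta> j k))" for j
    using summable_norm_comparison_test[OF _ A, of "\<alpha> j"] \<alpha>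
      summable_norm_comparison_test[OF _ B, of "\<beta> j"] \<beta> by auto
  define c where "c j n = (\<Sum>k\<le>n. \<alpha> j k * \<beta> j (n - k))" for j n
  have c: "c j sums ((\<Sum>k. \<alpha> j k) * (\<Sum>k. \<beta> j k))" for j
    unfolding c_def by (rule Cauchy_product_sums[OF \<alpha>' \<beta>'])
  define V where "V n = (\<Sum>k\<le>n. A k * B (n - k))" for n
  have "(\<lambda>j. \<Sum>n. w j * c j n) sums (\<Sum>n. \<Sum>j. w j * c j n)"
  proof (rule sums_swap_dominated)
    show "norm (w j * c j n) \<le> norm (w j) * V n" for j n
      unfolding c_def V_def norm_mult
      by (intro mult_left_mono sum_norm_le) (auto simp: norm_mult intro!: mult_mono \<alpha> \<beta> A0)
    show "summable V"
      unfolding V_def using A B A0 B0 by (intro summable_Cauchy_product) auto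
    show "V n \<ge> 0" for n
      unfolding V_def by (intro sum_nonneg mult_nonneg_nonneg A0 B0)
  qed (use w in auto)
  moreover have "(\<Sum>n. w j * c j n) = w j * ((\<Sum>k. \<alpha> j k) * (\<Sum>k. \<beta> j k))" for j
    using sums_mult[OF c, of "w j" j] by (simp add: sums_iff)
  moreover have "(\<Sum>j. w j * c j n) = (\<Sum>k\<le>n. \<Sum>j. w j * \<alpha> j k * \<beta> j (n - k))" for n
  proof -
    have "summable (\<lambda>j. w j * \<alpha> j k * \<beta> j m)" for k m
    proof (rule summable_norm_cancel, rule summable_norm_comparison_test)
      show "summable (\<lambda>j. norm (w j) * (A k * B m))"
        by (intro summable_mult2 w)
      have "norm (w j * \<alpha> j k * \<beta> j m) \<le> norm (w j) * (A k * B m)" for j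
        unfolding norm_mult mult.assoc by (intro mult_left_mono mult_mono \<alpha> \<beta> A0) auto
      then show "\<exists>N. \<forall>j\<ge>N. norm (w j * \<alpha> j k * \<beta> j m) \<le> norm (w j) * (A k * B m)"
        by blast
    qed
    then show ?thesis
      by (simp add: c_def sum_distrib_left mult.assoc suminf_sum[symmetric])
  qed
  ultimately show ?thesis
    by simp
qed

text \<open>The inner summation over $j$: the terms with $j < k$ vanish, and after cancellation of $(q;q)_j$
  the rest is Euler's series for $1/(a;q)_\<infinity>$.\<close>

lemma sums_qbinom:
  assumes q: "norm q < 1" and a: "norm a < 1"
  shows "(\<lambda>j. a ^ j / qpoch q q j * qbinom q j k) sums (a ^ k / qpoch q q k / qpoch_inf a q)"
proof -
  have "(\<lambda>i. a ^ k / qpoch q q k * (a ^ i / qpoch q q i)) sums (a ^ k / qpoch q q k * (1 / qpoch_inf a q))"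
    by (intro sums_mult Euler_sum_inverse q a)
  moreover have "a ^ (i + k) / qpoch q q (i + k) * qbinom q (i + k) k =
      a ^ k / qpoch q q k * (a ^ i / qpoch q q i)" for i
    using qpoch_self_nonzero[OF q] by (simp add: qbinom_def power_add)
  ultimately have "(\<lambda>i. a ^ (i + k) / qpoch q q (i + k) * qbinom q (i + k) k) sums
      (a ^ k / qpoch q q k / qpoch_inf a q)"
    by simp
  then show ?thesis
    by (subst (asm) sums_zero_iff_shift) auto
qed

section \<open>Two expansions of a partial theta function\<close>

lemma summable_norm_weights:
  assumes q: "norm q < 1" and a: "norm a < 1"
  shows "summable (\<lambda>j. norm (a ^ j / qpoch q q j))"
proof -
  obtain D where D: "D \<ge> 0" "\<And>n. norm (1 / qpoch q q n) \<le> D"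
    using qpoch_self_inverse_bounded[OF q] by blast
  show ?thesis
  proof (rule summable_norm_comparison_test)
    show "summable (\<lambda>k. norm a ^ k * D)"
      using a by (intro summable_mult2 summable_geometric) simp
    have "norm (a ^ k / qpoch q q k) \<le> norm a ^ k * D" for k
      using mult_left_mono[OF D(2)[of k], of "norm a ^ k"]
      by (simp add: norm_divide norm_power)
    then show "\<exists>N. \<forall>k\<ge>N. norm (a ^ k / qpoch q q k) \<le> norm a ^ k * D"
      by blast
  qed
qed

lemma norm_mult_power_le: "norm (z * r) ^ k \<le> norm z ^ k" if "norm r \<le> 1" for z r :: complex
  using that by (intro power_mono) (auto simp: norm_mult mult_left_le)

lemma suminf_partial_theta_divide:
  fixes q w c :: complex
  assumes q: "norm q < 1"
  shows "(\<Sum>n. q ^ (n choose 2) * w ^ n / c) = (\<Sum>n. q ^ (n choose 2) * w ^ n) / c"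
proof (rule suminf_divide)
  show "summable (\<lambda>n. q ^ (n choose 2) * w ^ n)"
    by (rule summable_norm_cancel) (simp add: norm_mult norm_power summable_partial_theta[OF q])
qed

text \<open>The infinite product is expanded by Euler's series, the finite one by the $q$-binomial theorem.
  Summing over $j$ leaves, as coefficient of $z^n$, a multiple of the sum evaluated in
  \<open>terminating_sum_base_q\<close>.\<close>

theorem partial_theta_base_q:
  assumes q: "norm q < 1"
  shows "(\<lambda>j. q ^ j / qpoch q q j * (qpoch_inf (z * q ^ (2 * j + 2)) (q ^ 2) * qpoch (- (z * q ^ j)) q j)) sums
           ((\<Sum>n. (q ^ 4) ^ (n choose 2) * (z * q ^ 3) ^ n) / qpoch_inf q q)"
proof -
  have q2: "norm (q ^ 2) < 1" and q4: "norm (q ^ 4) < 1"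
    using q by (simp_all add: norm_power power_less_one_iff)
  have pow_le: "norm (q ^ n) \<le> 1" for n
    using q by (simp add: norm_power power_le_one)
  define \<alpha> where "\<alpha> j m = (-1) ^ m * (q ^ 2) ^ (m choose 2) * (z * q ^ (2 * j + 2)) ^ m /
    qpoch (q ^ 2) (q ^ 2) m" for j m
  define \<beta> where "\<beta> j k = qbinom q j k * ((-1) ^ k * q ^ (k choose 2) * (- (z * q ^ j)) ^ k)" for j k
  obtain C where C: "C \<ge> 0" "\<And>n k. norm (qbinom q n k) \<le> C / norm (qpoch q q k)"
    using qbinom_bounded[OF q] by blast
  define A where "A m = norm ((-1) ^ m * (q ^ 2) ^ (m choose 2) * z ^ m / qpoch (q ^ 2) (q ^ 2) m)" for m
  define B where "B k = C * norm ((-1) ^ k * q ^ (k choose 2) * z ^ k / qpoch q q k)" for k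
  have "(\<lambda>j. q ^ j / qpoch q q j * ((\<Sum>k. \<alpha> j k) * (\<Sum>k. \<beta> j k))) sums
           (\<Sum>n. \<Sum>k\<le>n. \<Sum>j. q ^ j / qpoch q q j * \<alpha> j k * \<beta> j (n - k))"
  proof (rule sums_weighted_products)
    show "summable (\<lambda>j. norm (q ^ j / qpoch q q j))"
      by (rule summable_norm_weights[OF q q])
    show "summable A"
      unfolding A_def by (rule summable_Euler_terms[OF q2])
    show "summable B"
      unfolding B_def by (intro summable_mult summable_Euler_terms q)
    show "norm (\<alpha> j k) \<le> A k" for j k
      unfolding \<alpha>_def A_def norm_mult norm_divide norm_power[of _ k]
      by (intro divide_right_mono mult_left_mono norm_mult_power_le[unfolded norm_mult] pow_le) auto
    show "norm (\<beta> j k) \<le> B k" for j k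
    proof -
      have "norm (\<beta> j k) = norm (qbinom q j k) * (norm (q ^ (k choose 2)) * norm (z * q ^ j) ^ k)"
        by (simp add: \<beta>_def norm_mult norm_power)
      also have "\<dots> \<le> C / norm (qpoch q q k) * (norm (q ^ (k choose 2)) * norm z ^ k)"
        using C(1) by (intro mult_mono C norm_mult_power_le pow_le) auto
      also have "\<dots> = B k"
        by (simp add: B_def norm_mult norm_divide norm_power)
      finally show ?thesis .
    qed
  qed
  moreover have "(\<Sum>k. \<alpha> j k) = qpoch_inf (z * q ^ (2 * j + 2)) (q ^ 2)" for j
    unfolding \<alpha>_def by (rule sums_unique[symmetric], rule Euler_sum_product[OF q2])
  moreover have "(\<Sum>k. \<beta> j k) = qpoch (- (z * q ^ j)) q j" for j
    unfolding q_binomial[OF q] \<beta>_def by (rule suminf_finite) auto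
  moreover have "(\<Sum>k\<le>n. \<Sum>j. q ^ j / qpoch q q j * \<alpha> j k * \<beta> j (n - k)) =
      (q ^ 4) ^ (n choose 2) * (z * q ^ 3) ^ n / qpoch_inf q q" for n
  proof -
    have "(\<Sum>j. q ^ j / qpoch q q j * \<alpha> j m * \<beta> j (n - m)) =
        q ^ (n * n + n) * z ^ n / qpoch_inf q q *
        ((-1) ^ m * q ^ ((n - m) choose 2) * qpoch q q (n + m) /
            (qpoch (q ^ 2) (q ^ 2) m * qpoch q q (n - m)))" if "m \<le> n" for m
    proof -
      define k where "k = n - m"
      have n: "n = m + k"
        using that by (simp add: k_def)
      define a where "a = q * q ^ (2 * m + k)"
      have a: "norm a < 1"
        using q by (simp add: a_def norm_power power_less_one_iff flip: power_Suc)
      define K where "K = (-1) ^ m * (q ^ 2) ^ (m choose 2) * (z * q ^ 2) ^ m / qpoch (q ^ 2) (q ^ 2) m *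
        (q ^ (k choose 2) * z ^ k)"
      have "q ^ j / qpoch q q j * \<alpha> j m * \<beta> j k = K * (a ^ j / qpoch q q j * qbinom q j k)" for j
      proof -
        define G where "G = (-1) ^ m * (q ^ 2) ^ (m choose 2) * z ^ m / qpoch (q ^ 2) (q ^ 2) m *
          q ^ (k choose 2) * qbinom q j k / qpoch q q j"
        have e1: "q ^ j * (q ^ (2 * j + 2)) ^ m * (q ^ j) ^ k = (q ^ 2) ^ m * a ^ j"
        proof -
          have "j + (2 * j + 2) * m + j * k = 2 * m + Suc (2 * m + k) * j"
            by (simp add: algebra_simps)
          then show ?thesis
            by (simp only: a_def flip: power_Suc power_mult power_add)
        qed
        have e2: "(-1) ^ k * (- (z * q ^ j)) ^ k = z ^ k * (q ^ j) ^ k"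
          by (simp flip: power_mult_distrib)
        have "q ^ j / qpoch q q j * \<alpha> j m * \<beta> j k =
            (q ^ j * (q ^ (2 * j + 2)) ^ m * ((-1) ^ k * (- (z * q ^ j)) ^ k)) * G"
          by (simp only: \<alpha>_def \<beta>_def G_def power_mult_distrib[of z]) (simp add: mult_ac)
        also have "\<dots> = (q ^ j * (q ^ (2 * j + 2)) ^ m * (q ^ j) ^ k) * z ^ k * G"
          unfolding e2 by (simp only: mult_ac)
        also have "\<dots> = K * (a ^ j / qpoch q q j * qbinom q j k)"
          unfolding e1 by (simp add: K_def G_def power_mult_distrib)
        finally show ?thesis .
      qed
      then have "(\<Sum>j. q ^ j / qpoch q q j * \<alpha> j m * \<beta> j k) = K * (a ^ k / qpoch q q k / qpoch_inf a q)"
        using sums_mult[OF sums_qbinom[OF q a, of k], of K] by (simp only: sums_iff)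
      also have "\<dots> = ((-1) ^ m * z ^ m * z ^ k / qpoch (q ^ 2) (q ^ 2) m / qpoch q q k) *
          ((q ^ 2) ^ (m choose 2) * (q ^ 2) ^ m * q ^ (k choose 2) * a ^ k) * (1 / qpoch_inf a q)"
        by (simp add: K_def power_mult_distrib mult_ac)
      also have "(q ^ 2) ^ (m choose 2) * (q ^ 2) ^ m * q ^ (k choose 2) * a ^ k =
          q ^ (n * n + n) * q ^ (k choose 2)"
      proof -
        have "2 * (m choose 2) + 2 * m + (k choose 2) + Suc (2 * m + k) * k = n * n + n + (k choose 2)"
          using twice_choose_two[of m] by (simp add: n algebra_simps)
        then show ?thesis
          by (simp only: a_def flip: power_Suc power_mult power_add)
      qed
      also have "1 / qpoch_inf a q = qpoch q q (n + m) / qpoch_inf q q"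
      proof -
        have "qpoch_inf q q = qpoch q q (n + m) * qpoch_inf a q"
          using qpoch_inf_split[OF q, of q "2 * m + k"] by (simp add: a_def n mult_2 add_ac)
        then show ?thesis
          using qpoch_inf_self_nonzero[OF q] by (auto simp: divide_simps)
      qed
      finally have sum_eq: "(\<Sum>j. q ^ j / qpoch q q j * \<alpha> j m * \<beta> j k) =
          (-1) ^ m * z ^ m * z ^ k / qpoch (q ^ 2) (q ^ 2) m / qpoch q q k *
          (q ^ (n * n + n) * q ^ (k choose 2)) * (qpoch q q (n + m) / qpoch_inf q q)" .
      have zn: "z ^ n = z ^ m * z ^ k"
        by (simp only: n power_add)
      show ?thesis
        unfolding k_def[symmetric] sum_eq zn by (simp add: mult_ac)
    qed
    then have "(\<Sum>k\<le>n. \<Sum>j. q ^ j / qpoch q q j * \<alpha> j k * \<beta> j (n - k)) =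
        q ^ (n * n + n) * z ^ n / qpoch_inf q q * q ^ (n * n)"
      unfolding terminating_sum_base_q[OF q, symmetric] sum_distrib_left by simp
    also have "\<dots> = (q ^ 4) ^ (n choose 2) * (z * q ^ 3) ^ n / qpoch_inf q q"
    proof -
      have "n * n + n + n * n = 4 * (n choose 2) + 3 * n"
        using twice_choose_two[of n] by simp
      then have "q ^ (n * n + n) * q ^ (n * n) = (q ^ 4) ^ (n choose 2) * (q ^ 3) ^ n"
        by (simp only: flip: power_mult power_add)
      then show ?thesis
        by (simp add: power_mult_distrib mult_ac)
    qed
    finally show ?thesis .
  qed
  ultimately show ?thesis
    by (simp add: suminf_partial_theta_divide[OF q4])
qed

text \<open>The finite product is a polynomial in $y^2$ and the infinite one a power series in $y$, so the
  coefficient of $y^n$ collects the pairs with $2k + m = n$ and is evaluated by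
  \<open>terminating_sum_base_p\<close>. The same product could be written as
  $(yp^j;p)_j (-yp^j;p)_\<infinity>$, but the coefficients of that form do not cancel $(p^2;p^2)_j$ and leave a
  sum over $j$ without a closed form.\<close>

theorem partial_theta_base_p:
  assumes p0: "p \<noteq> 0" and p: "norm p < 1"
  shows "(\<lambda>j. p ^ j / qpoch (p ^ 2) (p ^ 2) j *
            (qpoch (y ^ 2 * (p ^ 2) ^ j) (p ^ 2) j * qpoch_inf (- (y * (p ^ 2) ^ j)) p)) sums
           ((\<Sum>n. p ^ (n choose 2) * y ^ n) / qpoch_inf p (p ^ 2))"
proof -
  define P where "P = p ^ 2"
  have P: "norm P < 1"
    using p by (simp add: P_def norm_power power_less_one_iff)
  have pow_le: "norm (P ^ n) \<le> 1" for n
    using P by (simp add: norm_power power_le_one)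
  have pP: "p * P ^ k = p ^ Suc (2 * k)" for k
    by (simp add: P_def power_mult)
  have pP_inf: "qpoch_inf p P \<noteq> 0"
    unfolding pP by (intro qpoch_inf_nonzero P) (use power_neq_1[OF p] in \<open>simp only: pP not_False_eq_True\<close>)
  define \<alpha>' where "\<alpha>' j k = qbinom P j k * ((-1) ^ k * P ^ (k choose 2) * (y ^ 2 * P ^ j) ^ k)" for j k
  \<comment> \<open>Only even powers of $y$ occur, but the Cauchy product needs an index for every power.\<close>
  define \<alpha> where "\<alpha> j k = (if even k then \<alpha>' j (k div 2) else 0)" for j k
  define \<beta> where "\<beta> j m = (-1) ^ m * p ^ (m choose 2) * (- (y * P ^ j)) ^ m / qpoch p p m" for j m
  obtain C where C: "C \<ge> 0" "\<And>n k. norm (qbinom P n k) \<le> C / norm (qpoch P P k)"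
    using qbinom_bounded[OF P] by blast
  define A' where "A' k = C * norm ((-1) ^ k * P ^ (k choose 2) * (y ^ 2) ^ k / qpoch P P k)" for k
  define A where "A k = (if even k then A' (k div 2) else 0)" for k
  define B where "B m = norm ((-1) ^ m * p ^ (m choose 2) * y ^ m / qpoch p p m)" for m
  have mono: "strict_mono ((*) (2::nat))"
    by (simp add: strict_mono_def)
  have "(\<lambda>j. p ^ j / qpoch P P j * ((\<Sum>k. \<alpha> j k) * (\<Sum>k. \<beta> j k))) sums
           (\<Sum>n. \<Sum>k\<le>n. \<Sum>j. p ^ j / qpoch P P j * \<alpha> j k * \<beta> j (n - k))"
  proof (rule sums_weighted_products)
    show "summable (\<lambda>j. norm (p ^ j / qpoch P P j))"
      by (rule summable_norm_weights[OF P p])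
    have "summable A'"
      unfolding A'_def by (intro summable_mult summable_Euler_terms P)
    then have "summable (\<lambda>k. A (2 * k))"
      by (simp add: A_def)
    then show "summable A"
      by (subst (asm) summable_mono_reindex[OF mono]) (auto simp: A_def elim!: evenE)
    show "summable B"
      unfolding B_def by (rule summable_Euler_terms[OF p])
    have "norm (\<alpha>' j k) \<le> A' k" for j k
    proof -
      have "norm (\<alpha>' j k) = norm (qbinom P j k) * (norm (P ^ (k choose 2)) * norm (y ^ 2 * P ^ j) ^ k)"
        by (simp add: \<alpha>'_def norm_mult norm_power)
      also have "\<dots> \<le> C / norm (qpoch P P k) * (norm (P ^ (k choose 2)) * norm (y ^ 2) ^ k)"
        using C(1) by (intro mult_mono C norm_mult_power_le pow_le) auto
      also have "\<dots> = A' k"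
        by (simp add: A'_def norm_mult norm_divide norm_power)
      finally show ?thesis .
    qed
    then show "norm (\<alpha> j k) \<le> A k" for j k
      by (simp add: \<alpha>_def A_def)
    have "norm (- (y * P ^ j)) ^ m \<le> norm y ^ m" for j m
      using norm_mult_power_le[OF pow_le] by simp
    then show "norm (\<beta> j m) \<le> B m" for j m
      unfolding \<beta>_def B_def norm_mult norm_divide norm_power[of _ m]
      by (intro divide_right_mono mult_left_mono) auto
  qed
  moreover have "(\<Sum>k. \<alpha> j k) = qpoch (y ^ 2 * P ^ j) P j" for j
  proof -
    have "(\<Sum>k. \<alpha> j k) = (\<Sum>k. \<alpha> j (2 * k))"
      by (rule suminf_mono_reindex[OF mono, symmetric]) (auto simp: \<alpha>_def elim!: evenE)
    also have "\<dots> = qpoch (y ^ 2 * P ^ j) P j"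
      unfolding q_binomial[OF P] by (simp add: \<alpha>_def \<alpha>'_def, rule suminf_finite) auto
    finally show ?thesis .
  qed
  moreover have "(\<Sum>k. \<beta> j k) = qpoch_inf (- (y * P ^ j)) p" for j
    unfolding \<beta>_def by (rule sums_unique[symmetric], rule Euler_sum_product[OF p])
  moreover have "(\<Sum>k\<le>n. \<Sum>j. p ^ j / qpoch P P j * \<alpha> j k * \<beta> j (n - k)) =
      p ^ (n choose 2) * y ^ n / qpoch_inf p P" for n
  proof -
    have inner: "(\<Sum>j. p ^ j / qpoch P P j * \<alpha>' j k * \<beta> j (n - 2 * k)) =
        p ^ (n choose 2) * y ^ n / qpoch_inf p P *
        ((-1) ^ k * p ^ (k * Suc k) * qpoch p P (n - k) / (qpoch P P k * qpoch p p (n - 2 * k)))"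
      if "2 * k \<le> n" for k
    proof -
      define m where "m = n - 2 * k"
      have n: "n = m + 2 * k"
        using that by (simp add: m_def)
      define a where "a = p * P ^ (k + m)"
      have a: "norm a < 1"
        unfolding a_def pP using p by (simp add: norm_power power_less_one_iff del: power_Suc)
      define K where "K = (-1) ^ k * P ^ (k choose 2) * (y ^ 2) ^ k * (p ^ (m choose 2) * y ^ m / qpoch p p m)"
      have "p ^ j / qpoch P P j * \<alpha>' j k * \<beta> j m = K * (a ^ j / qpoch P P j * qbinom P j k)" for j
      proof -
        define G where "G = (-1) ^ k * P ^ (k choose 2) * (y ^ 2) ^ k * p ^ (m choose 2) *
          qbinom P j k / qpoch P P j / qpoch p p m"
        have e1: "p ^ j * (P ^ j) ^ k * (P ^ j) ^ m = a ^ j"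
        proof -
          have "j * k + j * m = (k + m) * j"
            by (simp add: algebra_simps)
          then show ?thesis
            by (simp only: a_def power_mult_distrib mult.assoc flip: power_mult power_add)
        qed
        have e2: "(-1) ^ m * (- (y * P ^ j)) ^ m = y ^ m * (P ^ j) ^ m"
          by (simp flip: power_mult_distrib)
        have "p ^ j / qpoch P P j * \<alpha>' j k * \<beta> j m =
            (p ^ j * (P ^ j) ^ k * ((-1) ^ m * (- (y * P ^ j)) ^ m)) * G"
          by (simp only: \<alpha>'_def \<beta>_def G_def power_mult_distrib[of "y ^ 2"]) (simp add: mult_ac)
        also have "\<dots> = (p ^ j * (P ^ j) ^ k * (P ^ j) ^ m) * y ^ m * G"
          unfolding e2 by (simp only: mult_ac)
        also have "\<dots> = K * (a ^ j / qpoch P P j * qbinom P j k)"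
          unfolding e1 by (simp add: K_def G_def mult_ac)
        finally show ?thesis .
      qed
      then have "(\<Sum>j. p ^ j / qpoch P P j * \<alpha>' j k * \<beta> j m) = K * (a ^ k / qpoch P P k / qpoch_inf a P)"
        using sums_mult[OF sums_qbinom[OF P a, of k], of K] by (simp only: sums_iff)
      also have "\<dots> = ((-1) ^ k * ((y ^ 2) ^ k * y ^ m) / qpoch P P k / qpoch p p m) *
          (P ^ (k choose 2) * p ^ (m choose 2) * a ^ k) * (1 / qpoch_inf a P)"
        by (simp add: K_def mult_ac)
      also have "P ^ (k choose 2) * p ^ (m choose 2) * a ^ k = p ^ (n choose 2) * p ^ (k * Suc k)"
      proof -
        \<comment> \<open>Doubled, because the binomial coefficients are known only through $2\binom{n}{2} + n = n^2$.\<close>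
        have "2 * (2 * (k choose 2) + (m choose 2) + Suc (2 * (k + m)) * k) =
            2 * ((n choose 2) + k * Suc k)"
          using twice_choose_two[of m] twice_choose_two[of n] twice_choose_two[of k]
          by (simp add: n algebra_simps)
        then have "2 * (k choose 2) + (m choose 2) + Suc (2 * (k + m)) * k = (n choose 2) + k * Suc k"
          by simp
        then show ?thesis
          unfolding a_def pP unfolding P_def by (simp only: flip: power_mult power_add)
      qed
      also have "1 / qpoch_inf a P = qpoch p P (n - k) / qpoch_inf p P"
      proof -
        have "qpoch_inf p P = qpoch p P (n - k) * qpoch_inf a P"
          using qpoch_inf_split[OF P, of p "k + m"] by (simp add: a_def n mult_2 add_ac)
        then show ?thesis
          using pP_inf by (auto simp: divide_simps)
      qed
      also have "(y ^ 2) ^ k * y ^ m = y ^ n"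
        by (simp only: n add.commute[of m] flip: power_mult power_add)
      finally show ?thesis
        unfolding m_def[symmetric] by (simp add: mult_ac)
    qed
    have "(\<Sum>k\<le>n. \<Sum>j. p ^ j / qpoch P P j * \<alpha> j k * \<beta> j (n - k)) =
        (\<Sum>k\<in>(*) 2 ` {k. 2 * k \<le> n}. \<Sum>j. p ^ j / qpoch P P j * \<alpha> j k * \<beta> j (n - k))"
    proof (rule sum.mono_neutral_right)
      have "odd i" if "i \<in> {..n} - (*) 2 ` {k. 2 * k \<le> n}" for i
      proof
        assume "even i"
        then have "i = 2 * (i div 2)"
          by simp
        moreover have "i div 2 \<in> {k. 2 * k \<le> n}"
          using that by auto
        ultimately show False
          using that by blast
      qed
      then have "\<alpha> j i = 0" if "i \<in> {..n} - (*) 2 ` {k. 2 * k \<le> n}" for i j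
        using that unfolding \<alpha>_def by presburger
      then show "\<forall>i\<in>{..n} - (*) 2 ` {k. 2 * k \<le> n}.
          (\<Sum>j. p ^ j / qpoch P P j * \<alpha> j i * \<beta> j (n - i)) = 0"
        by (intro ballI) (simp only: mult_zero_right mult_zero_left suminf_zero)
      show "{..n} \<supseteq> (*) 2 ` {k. 2 * k \<le> n}"
        by auto
    qed simp
    also have "\<dots> = (\<Sum>k | 2 * k \<le> n. \<Sum>j. p ^ j / qpoch P P j * \<alpha>' j k * \<beta> j (n - 2 * k))"
      by (subst sum.reindex) (auto simp: inj_on_def \<alpha>_def)
    also have "\<dots> = (\<Sum>k | 2 * k \<le> n. p ^ (n choose 2) * y ^ n / qpoch_inf p P *
        ((-1) ^ k * p ^ (k * Suc k) * qpoch p P (n - k) / (qpoch P P k * qpoch p p (n - 2 * k))))"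
      by (intro sum.cong refl inner) simp
    also have "\<dots> = p ^ (n choose 2) * y ^ n / qpoch_inf p P"
      unfolding sum_distrib_left[symmetric] terminating_sum_base_p[OF p0 p, folded P_def, of n]
      by (rule mult_1_right)
    finally show ?thesis .
  qed
  ultimately show ?thesis
    unfolding P_def[symmetric] by (simp add: suminf_partial_theta_divide[OF p])
qed

section \<open>The transformation\<close>

text \<open>Pairing each square root with its negative doubles the base; the two resulting factors interleave
  to a single shifted factorial of twice the length. Hence the choice of the roots is immaterial.\<close>

lemma qpoch_double_base:
  "qpoch s q j * qpoch (- s) q j * (qpoch t q j * qpoch (- t) q j) = qpoch w q (2 * j)"
  if "s ^ 2 = w * q" "t ^ 2 = w"
  using qpoch_even_odd[of w q j] by (simp add: qpoch_minus that mult_ac)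

theorem mainTheorem2:
  fixes q x s t u :: complex
  assumes "0 < norm q" and "norm q < 1"
    and "\<And>k::nat. x ^ 2 * q ^ (8 * k + 4) \<noteq> 1"
    and "\<And>k::nat. - x * q powi (int k - 1) \<noteq> 1"
    and "\<And>k::nat. x * q ^ (2 * k + 1) \<noteq> 1"
    and "s ^ 2 = - x" and "t ^ 2 = - x / q" and "u ^ 2 = x * q"
  shows "basic_hypergeom [x * q ^ 2, x * q ^ 6] [x ^ 2 * q ^ 4] (q ^ 8) (q ^ 4) =
    qpoch_inf q q * qpoch_inf (x * q) (q ^ 2) /
      (qpoch_inf (q ^ 4) (q ^ 8) * qpoch_inf (- x * q ^ 2) (q ^ 4)) *
    basic_hypergeom [s, - s, t, - t] [- x / q, u, - u] q q"
proof -
  have q0: "q \<noteq> 0" and q: "norm q < 1"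
    using assms by auto
  define z where "z = x / q"
  define p where "p = q ^ 4"
  define y where "y = x * q ^ 2"
  have x: "x = z * q"
    using q0 by (simp add: z_def)
  have p0: "p \<noteq> 0" and p: "norm p < 1" and q2: "norm (q ^ 2) < 1"
    using q q0 by (simp_all add: p_def norm_power power_less_one_iff)
  have p2_eq: "q ^ 8 = p ^ 2"
    by (simp add: p_def flip: power_mult)
  have yp: "y * p = x * q ^ 6"
    by (simp add: y_def p_def flip: power_add)
  have y2_nz: "y ^ 2 * (p ^ 2) ^ k \<noteq> 1" for k
    using assms(3)[of k] by (simp add: y_def p_def power_mult_distrib power_add mult_ac flip: power_mult)
  have y_nz: "- y * p ^ k \<noteq> 1" for k
  proof
    assume "- y * p ^ k = 1"
    then have "(- y * p ^ k) ^ 2 = 1"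
      by simp
    then show False
      using y2_nz[of k] by (simp add: power_mult_distrib flip: power_mult) (simp add: mult.commute)
  qed
  have z_nz: "- z * q ^ k \<noteq> 1" for k
    using assms(4)[of k] q0 by (simp add: z_def power_int_diff)
  have xq_nz: "x * q * (q ^ 2) ^ k \<noteq> 1" for k
    using assms(5)[of k] by (simp add: mult_ac flip: power_mult)
  \<comment> \<open>The partial theta function to which both sides reduce; in terms of $x$ it is
    $\sum_n q^{2n^2} x^n$.\<close>
  define \<Theta> where "\<Theta> = (\<Sum>n. p ^ (n choose 2) * y ^ n)"
  define c where "c = qpoch_inf (- y) p"
  define d where "d = qpoch_inf (x * q) (q ^ 2)"
  have c0: "c \<noteq> 0"
    unfolding c_def by (rule qpoch_inf_nonzero[OF p y_nz])
  have d0: "d \<noteq> 0"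
    unfolding d_def by (rule qpoch_inf_nonzero[OF q2 xq_nz])

  have lhs_term: "qpoch_list [x * q ^ 2, x * q ^ 6] (q ^ 8) j / qpoch_list [q ^ 8, x ^ 2 * q ^ 4] (q ^ 8) j * (q ^ 4) ^ j =
      p ^ j / qpoch (p ^ 2) (p ^ 2) j *
      (qpoch (y ^ 2 * (p ^ 2) ^ j) (p ^ 2) j * qpoch_inf (- (y * (p ^ 2) ^ j)) p) / c" for j
  proof -
    have "qpoch_list [x * q ^ 2, x * q ^ 6] (q ^ 8) j = qpoch y (p ^ 2) j * qpoch (y * p) (p ^ 2) j"
      unfolding qpoch_list_def p2_eq yp by (simp add: y_def)
    then have num: "qpoch_list [x * q ^ 2, x * q ^ 6] (q ^ 8) j = qpoch y p (2 * j)"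
      by (simp only: qpoch_even_odd)
    have den: "qpoch_list [q ^ 8, x ^ 2 * q ^ 4] (q ^ 8) j = qpoch (p ^ 2) (p ^ 2) j * qpoch (y ^ 2) (p ^ 2) j"
      by (simp add: qpoch_list_def p2_eq y_def power_mult_distrib flip: power_mult)
    have c: "c = qpoch (- y) p (2 * j) * qpoch_inf (- (y * (p ^ 2) ^ j)) p"
      unfolding c_def using qpoch_inf_split[OF p, of "- y" "2 * j"] by (simp add: power_mult)
    have "qpoch y p (2 * j) * c =
        qpoch (y ^ 2) (p ^ 2) (j + j) * qpoch_inf (- (y * (p ^ 2) ^ j)) p"
      unfolding c by (simp add: mult_2 flip: qpoch_minus)
    also have "\<dots> = qpoch (y ^ 2) (p ^ 2) j *
        (qpoch (y ^ 2 * (p ^ 2) ^ j) (p ^ 2) j * qpoch_inf (- (y * (p ^ 2) ^ j)) p)"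
      unfolding qpoch_add by (simp only: mult.assoc)
    finally have *: "qpoch y p (2 * j) / qpoch (y ^ 2) (p ^ 2) j =
        qpoch (y ^ 2 * (p ^ 2) ^ j) (p ^ 2) j * qpoch_inf (- (y * (p ^ 2) ^ j)) p / c"
      using c0 qpoch_nonzero[OF y2_nz, of j] by (simp add: frac_eq_eq mult.commute)
    have "qpoch y p (2 * j) / (qpoch (p ^ 2) (p ^ 2) j * qpoch (y ^ 2) (p ^ 2) j) * p ^ j =
        p ^ j / qpoch (p ^ 2) (p ^ 2) j * (qpoch y p (2 * j) / qpoch (y ^ 2) (p ^ 2) j)"
      by simp
    then show ?thesis
      unfolding num den * unfolding p_def[symmetric] by simp
  qed
  have lhs: "basic_hypergeom [x * q ^ 2, x * q ^ 6] [x ^ 2 * q ^ 4] (q ^ 8) (q ^ 4) =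
      \<Theta> / qpoch_inf p (p ^ 2) / c"
    unfolding basic_hypergeom_def lhs_term \<Theta>_def
    by (rule sums_unique[symmetric], rule sums_divide, rule partial_theta_base_p[OF p0 p])

  have rhs_term: "qpoch_list [s, - s, t, - t] q j / qpoch_list [q, - x / q, u, - u] q j * q ^ j =
      q ^ j / qpoch q q j *
      (qpoch_inf (z * q ^ (2 * j + 2)) (q ^ 2) * qpoch (- (z * q ^ j)) q j) / d" for j
  proof -
    have num: "qpoch_list [s, - s, t, - t] q j = qpoch (- z) q j * qpoch (- (z * q ^ j)) q j"
      using qpoch_double_base[of s "- z" q t j] assms(6,7) qpoch_add[of "- z" q j j]
      by (simp add: qpoch_list_def x q0 mult_2 mult.assoc)
    have den: "qpoch_list [q, - x / q, u, - u] q j =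
        qpoch q q j * (qpoch (- z) q j * qpoch (x * q) (q ^ 2) j)"
      using qpoch_minus[of u q j] assms(8) by (simp add: qpoch_list_def x q0)
    have "x * q * (q ^ 2) ^ j = z * q ^ (2 * j + 2)"
      by (simp add: x power_mult power2_eq_square)
    then have d: "d = qpoch (x * q) (q ^ 2) j * qpoch_inf (z * q ^ (2 * j + 2)) (q ^ 2)"
      unfolding d_def using qpoch_inf_split[OF q2, of "x * q" j] by (simp only:)
    show ?thesis
      unfolding num den using d0 unfolding d
      using qpoch_nonzero[OF z_nz, of j] by simp
  qed
  have y': "z * q ^ 3 = y"
    by (simp add: y_def x power3_eq_cube power2_eq_square)
  have rhs: "basic_hypergeom [s, - s, t, - t] [- x / q, u, - u] q q = \<Theta> / qpoch_inf q q / d"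
    unfolding basic_hypergeom_def rhs_term \<Theta>_def
    by (rule sums_unique[symmetric], rule sums_divide, rule partial_theta_base_q[OF q, of z, unfolded y', folded p_def])
  show ?thesis
    unfolding lhs rhs unfolding p2_eq d_def[symmetric] p_def[symmetric]
    using d0 qpoch_inf_self_nonzero[OF q] by (simp add: c_def y_def)
qed

end
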